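(* Let $\mathbf{C}$ be the natural deduction system described in the context. If $\Pi$ is a deduction in $\mathbf{C}$ in normal form, then every major premise of an application of an elimination rule in $\Pi$ is a (discharged or undischarged) assumption of $\Pi$.
   Context: Formulas are built from atomic formulas (formulas containing no connective) by the connectives $\neg$ (unary), $\supset$, $\land$, $\lor$. Deductions in $\mathbf{C}$ are trees of formula occurrences whose leaves are assumptions; each assumption belongs to an assumption class marked by a number, and a rule discharging class $i$ (written $[X]^i$) discharges all assumptions of that class above the indicated premise. A single assumption $A$ is a deduction of $A$ from $A$. Rules ($C$ arbitrary): $\land I$: from $A$, $B$, and a deduction of $C$ from $[A\land B]$, infer $C$. $\land E$: from $A\land B$ and a deduction of $C$ from $[A]$, $[B]$, infer $C$. $\lor I$: from $A$ (or from $B$) and a deduction of $C$ from $[A\lor B]$, infer $C$. $\lor E$: from $A\lor B$, a deduction of $C$ from $[A]$, and a deduction of $C$ from $[B]$, infer $C$. $\supset I$: from $B$ and a deduction of $C$ from $[A\supset B]$, infer $C$. $TR$ (an introduction rule for $\supset$): from a deduction of $C$ from $[A]$ and a deduction of $C$ from $[A\supset B]$, infer $C$. $\supset E$: from $A\supset B$, $A$, and a deduction of $C$ from $[B]$, infer $C$. $\neg I$: from a deduction of $C$ from $[A]$ and a deduction of $C$ from $[\neg A]$, infer $C$. $\neg E$: from $\neg A$ and $A$, infer $C$. Introduction rules: $\land I,\lor I,\supset I,TR,\neg I$; elimination rules: $\land E,\lor E,\supset E,\neg E$. In elimination rules $A\land B, A\lor B, A\supset B,\neg A$ are the major premises; premises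 in the place of $C$ (in any rule) are arbitrary premises; the discharged $A\land B$, $A\lor B$, $A\supset B$ (in $\supset I$ and $TR$), $\neg A$ (in $\neg I$) are the major assumptions discharged by the introduction rule. Convention: there is no vacuous discharge above arbitrary premises. A maximal formula is an occurrence of a formula with main connective $\ast$ that is both the major premise of an application of $\ast E$ and the major assumption discharged by an application of $\ast I$ (or of $TR$ when $\ast$ is $\supset$). A segment is a sequence $C_1,\dots,C_n$ of occurrences of the same formula such that for all $i<n$, $C_i$ is an arbitrary premise of a rule application whose conclusion is $C_{i+1}$, $C_n$ is not an arbitrary premise of any rule application, and either $n>1$, or $n\ge 1$ and $C_1$ is the conclusion of an application of $\neg E$. A maximal segment is a segment whose last formula is the major premise of an elimination rule. A deduction is in normal form if it contains neither maximal formulas nor maximal segments. *)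

theory Defs
  imports Main
begin

datatype 'a formula =
    Atom 'a
  | Neg "'a formula"
  | Imp "'a formula" "'a formula"
  | Con "'a formula" "'a formula"
  | Dis "'a formula" "'a formula"

datatype connective = NEG | IMP | CON | DIS

primrec main_connective :: "'a formula \<Rightarrow> connective option" where
  "main_connective (Atom x) = None"
| "main_connective (Neg A) = Some NEG"
| "main_connective (Imp A B) = Some IMP"
| "main_connective (Con A B) = Some CON"
| "main_connective (Dis A B) = Some DIS"

text \<open>
  A rule instance records its schematic formulas and the numbers of the assumption classes it
  discharges. The last formula argument is always the arbitrary conclusion.
\<close>

datatype 'a rule =
    ConI nat "'a formula" "'a formula" "'a formula"
  | ConE nat nat "'a formula" "'a formula" "'a formula"
  | DisI1 nat "'a formula" "'a formula" "'a formula"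
  | DisI2 nat "'a formula" "'a formula" "'a formula"
  | DisE nat nat "'a formula" "'a formula" "'a formula"
  | ImpI nat "'a formula" "'a formula" "'a formula"
  | TR nat nat "'a formula" "'a formula" "'a formula"
  | ImpE nat "'a formula" "'a formula" "'a formula"
  | NegI nat nat "'a formula" "'a formula"
  | NegE "'a formula" "'a formula"

primrec rule_concl :: "'a rule \<Rightarrow> 'a formula" where
  "rule_concl (ConI i A B C) = C"
| "rule_concl (ConE i j A B C) = C"
| "rule_concl (DisI1 i A B C) = C"
| "rule_concl (DisI2 i A B C) = C"
| "rule_concl (DisE i j A B C) = C"
| "rule_concl (ImpI i A B C) = C"
| "rule_concl (TR i j A B C) = C"
| "rule_concl (ImpE i A B C) = C"
| "rule_concl (NegI i j A C) = C"
| "rule_concl (NegE A C) = C"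

primrec intro_rule_for :: "'a rule \<Rightarrow> connective option" where
  "intro_rule_for (ConI i A B C) = Some CON"
| "intro_rule_for (ConE i j A B C) = None"
| "intro_rule_for (DisI1 i A B C) = Some DIS"
| "intro_rule_for (DisI2 i A B C) = Some DIS"
| "intro_rule_for (DisE i j A B C) = None"
| "intro_rule_for (ImpI i A B C) = Some IMP"
| "intro_rule_for (TR i j A B C) = Some IMP"
| "intro_rule_for (ImpE i A B C) = None"
| "intro_rule_for (NegI i j A C) = Some NEG"
| "intro_rule_for (NegE A C) = None"

primrec elim_rule_for :: "'a rule \<Rightarrow> connective option" where
  "elim_rule_for (ConI i A B C) = None"
| "elim_rule_for (ConE i j A B C) = Some CON"
| "elim_rule_for (DisI1 i A B C) = None"
| "elim_rule_for (DisI2 i A B C) = None"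
| "elim_rule_for (DisE i j A B C) = Some DIS"
| "elim_rule_for (ImpI i A B C) = None"
| "elim_rule_for (TR i j A B C) = None"
| "elim_rule_for (ImpE i A B C) = Some IMP"
| "elim_rule_for (NegI i j A C) = None"
| "elim_rule_for (NegE A C) = Some NEG"

text \<open>
  \<open>MajorAsm\<close> marks the major assumption discharged by an introduction rule, \<open>SideAsm\<close> any other
  discharged assumption.
\<close>

datatype 'a discharge =
    MajorAsm (dis_class: nat) (dis_formula: "'a formula")
  | SideAsm (dis_class: nat) (dis_formula: "'a formula")

text \<open>Only arbitrary premises have assumptions discharged above them.\<close>

datatype 'a premise =
    Major (prem_formula: "'a formula")
  | Minor (prem_formula: "'a formula")
  | Arbitrary (prem_formula: "'a formula") "'a discharge list"

primrec discharged :: "'a premise \<Rightarrow> 'a discharge set" where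
  "discharged (Major A) = {}"
| "discharged (Minor A) = {}"
| "discharged (Arbitrary A ds) = set ds"

primrec rule_premises :: "'a rule \<Rightarrow> 'a premise list" where
  "rule_premises (ConI i A B C) = [Minor A, Minor B, Arbitrary C [MajorAsm i (Con A B)]]"
| "rule_premises (ConE i j A B C) = [Major (Con A B), Arbitrary C [SideAsm i A, SideAsm j B]]"
| "rule_premises (DisI1 i A B C) = [Minor A, Arbitrary C [MajorAsm i (Dis A B)]]"
| "rule_premises (DisI2 i A B C) = [Minor B, Arbitrary C [MajorAsm i (Dis A B)]]"
| "rule_premises (DisE i j A B C) =
     [Major (Dis A B), Arbitrary C [SideAsm i A], Arbitrary C [SideAsm j B]]"
| "rule_premises (ImpI i A B C) = [Minor B, Arbitrary C [MajorAsm i (Imp A B)]]"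
| "rule_premises (TR i j A B C) = [Arbitrary C [SideAsm i A], Arbitrary C [MajorAsm j (Imp A B)]]"
| "rule_premises (ImpE i A B C) = [Major (Imp A B), Minor A, Arbitrary C [SideAsm i B]]"
| "rule_premises (NegI i j A C) = [Arbitrary C [SideAsm i A], Arbitrary C [MajorAsm j (Neg A)]]"
| "rule_premises (NegE A C) = [Major (Neg A), Minor A]"

datatype 'a tree =
    Assumption nat "'a formula"
  | Inference "'a rule" "'a tree list"

primrec concl :: "'a tree \<Rightarrow> 'a formula" where
  "concl (Assumption i A) = A"
| "concl (Inference r ts) = rule_concl r"

text \<open>
  A formula occurrence is addressed by the path from the root to it: \<open>[]\<close> is the conclusion of
  the tree, and \<open>p @ [k]\<close> is the \<open>k\<close>-th premise (from 0) of the inference with conclusion \<open>p\<close>.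
\<close>

type_synonym occ = "nat list"

fun subtree :: "'a tree \<Rightarrow> occ \<Rightarrow> 'a tree option" where
  "subtree t [] = Some t"
| "subtree (Assumption i A) (k # p) = None"
| "subtree (Inference r ts) (k # p) = (if k < length ts then subtree (ts ! k) p else None)"

definition formula_at :: "'a tree \<Rightarrow> occ \<Rightarrow> 'a formula option" where
  "formula_at t p = map_option concl (subtree t p)"

definition rule_at :: "'a tree \<Rightarrow> occ \<Rightarrow> 'a rule \<Rightarrow> bool" where
  "rule_at t p r \<longleftrightarrow> (\<exists>ts. subtree t p = Some (Inference r ts))"

definition assumption_at :: "'a tree \<Rightarrow> occ \<Rightarrow> bool" where
  "assumption_at t p \<longleftrightarrow> (\<exists>i A. subtree t p = Some (Assumption i A))"

text \<open>
  \<open>open_asm t p i A\<close>: the occurrence \<open>p\<close> is an undischarged assumption \<open>A\<close> of class \<open>i\<close> in \<open>t\<close>.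
  If a number is used by several inferences below a leaf, the uppermost one discharges it.
\<close>

inductive open_asm :: "'a tree \<Rightarrow> occ \<Rightarrow> nat \<Rightarrow> 'a formula \<Rightarrow> bool" where
  "open_asm (Assumption i A) [] i A"
| "\<lbrakk> k < length ts; k < length (rule_premises r); open_asm (ts ! k) p i A;
     i \<notin> dis_class ` discharged (rule_premises r ! k) \<rbrakk>
   \<Longrightarrow> open_asm (Inference r ts) (k # p) i A"

text \<open>
  The assumption class discharged by \<open>[X]\<^sup>i\<close> must consist of occurrences of \<open>X\<close>. Discharge above an
  arbitrary premise is not vacuous if some assumption is discharged there; for \<open>ConE\<close> it suffices
  that one of the two conjuncts is.
\<close>

inductive deduction :: "'a tree \<Rightarrow> bool" where
  "deduction (Assumption i A)"
| "\<lbrakk> length ts = length (rule_premises r);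
     \<And>k. k < length ts \<Longrightarrow> deduction (ts ! k);
     \<And>k. k < length ts \<Longrightarrow> concl (ts ! k) = prem_formula (rule_premises r ! k);
     \<And>k d p A. \<lbrakk> k < length ts; d \<in> discharged (rule_premises r ! k);
        open_asm (ts ! k) p (dis_class d) A \<rbrakk> \<Longrightarrow> A = dis_formula d;
     \<And>k. \<lbrakk> k < length ts; is_Arbitrary (rule_premises r ! k) \<rbrakk> \<Longrightarrow>
        \<exists>d \<in> discharged (rule_premises r ! k). \<exists>p A. open_asm (ts ! k) p (dis_class d) A \<rbrakk>
   \<Longrightarrow> deduction (Inference r ts)"

definition major_premise_of :: "'a tree \<Rightarrow> occ \<Rightarrow> 'a rule \<Rightarrow> bool" where
  "major_premise_of t p r \<longleftrightarrow> (\<exists>q k. p = q @ [k] \<and> rule_at t q r \<and>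
     k < length (rule_premises r) \<and> is_Major (rule_premises r ! k))"

definition arbitrary_premise_of :: "'a tree \<Rightarrow> occ \<Rightarrow> occ \<Rightarrow> bool" where
  "arbitrary_premise_of t p q \<longleftrightarrow> (\<exists>k r. p = q @ [k] \<and> rule_at t q r \<and>
     k < length (rule_premises r) \<and> is_Arbitrary (rule_premises r ! k))"

definition major_assumption_of :: "'a tree \<Rightarrow> occ \<Rightarrow> 'a rule \<Rightarrow> bool" where
  "major_assumption_of t p r \<longleftrightarrow>
     (\<exists>q ts k p' d A. subtree t q = Some (Inference r ts) \<and> k < length ts \<and>
        k < length (rule_premises r) \<and> p = q @ k # p' \<and>
        d \<in> discharged (rule_premises r ! k) \<and> is_MajorAsm d \<and>
        open_asm (ts ! k) p' (dis_class d) A)"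

definition elim_major_premise :: "'a tree \<Rightarrow> occ \<Rightarrow> bool" where
  "elim_major_premise t p \<longleftrightarrow>
     subtree t p \<noteq> None \<and> (\<exists>r. elim_rule_for r \<noteq> None \<and> major_premise_of t p r)"

definition maximal_formula :: "'a tree \<Rightarrow> occ \<Rightarrow> bool" where
  "maximal_formula t p \<longleftrightarrow>
     (\<exists>A c r r'. formula_at t p = Some A \<and> main_connective A = Some c \<and>
        elim_rule_for r = Some c \<and> major_premise_of t p r \<and>
        intro_rule_for r' = Some c \<and> major_assumption_of t p r')"

definition segment :: "'a tree \<Rightarrow> occ list \<Rightarrow> bool" where
  "segment t ps \<longleftrightarrow>
     ps \<noteq> [] \<and>
     (\<exists>C. \<forall>p \<in> set ps. formula_at t p = Some C) \<and>
     (\<forall>i. Suc i < length ps \<longrightarrow> arbitrary_premise_of t (ps ! i) (ps ! Suc i)) \<and>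
     \<not> (\<exists>q. arbitrary_premise_of t (last ps) q) \<and>
     (length ps > 1 \<or> length ps \<ge> 1 \<and> (\<exists>A C. rule_at t (hd ps) (NegE A C)))"

definition maximal_segment :: "'a tree \<Rightarrow> occ list \<Rightarrow> bool" where
  "maximal_segment t ps \<longleftrightarrow> segment t ps \<and> elim_major_premise t (last ps)"

definition normal_form :: "'a tree \<Rightarrow> bool" where
  "normal_form t \<longleftrightarrow> \<not> (\<exists>p. maximal_formula t p) \<and> \<not> (\<exists>ps. maximal_segment t ps)"

end

theory Submission
  imports Defs
begin

text \<open>
  Every inference either is an application of \<open>NegE\<close> or has an arbitrary premise. A major premise
  that is the conclusion of an inference therefore ends a segment: by itself in the first case,
  preceded by that arbitrary premise in the second. This segment is maximal.
\<close>

lemma subtree_append: "subtree t (p @ q) = Option.bind (subtree t p) (\<lambda>s. subtree s q)"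
  by (induction t p rule: subtree.induct) auto

lemma deduction_subtree:
  assumes "deduction t" and "subtree t p = Some s"
  shows "deduction s"
  using assms
  by (induction t p rule: subtree.induct) (auto elim: deduction.cases split: if_splits)

text \<open>Holds by inspection of the rules. The equation of formulas lets the premise and the
  conclusion be neighbours in a segment.\<close>

lemma NegE_or_arbitrary_premise:
  obtains (NegE) A C where "r = NegE A C"
  | (arbitrary) k where "k < length (rule_premises r)" "is_Arbitrary (rule_premises r ! k)"
      "prem_formula (rule_premises r ! k) = rule_concl r"
proof -
  have "(\<exists>A C. r = NegE A C) \<or>
      (\<exists>P \<in> set (rule_premises r). is_Arbitrary P \<and> prem_formula P = rule_concl r)"
    by (cases r) auto
  then show thesis
    using that by (metis in_set_conv_nth)
qed

text \<open>The path \<open>p = q @ [k]\<close> determines both the inference below \<open>p\<close>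
  and the premise number \<open>k\<close>, so both notions speak of the same premise, and a premise
  is of one kind only.\<close>

lemma major_premise_not_arbitrary:
  assumes "major_premise_of t p r"
  shows "\<not> arbitrary_premise_of t p q"
proof -
  have "\<not> is_Arbitrary P" if "is_Major P" for P :: "'a premise"
    using that by (cases P) auto
  then show ?thesis
    using assms unfolding major_premise_of_def arbitrary_premise_of_def rule_at_def by force
qed

lemma inference_conclusion_ends_segment:
  assumes "deduction t" and p: "subtree t p = Some (Inference r ts)"
    and last: "\<And>q. \<not> arbitrary_premise_of t p q"
  obtains ps where "segment t ps" "last ps = p"
proof (cases r rule: NegE_or_arbitrary_premise)
  case (NegE A C)
  then have "segment t [p]"
    using p last by (auto simp: segment_def formula_at_def rule_at_def)
  then show thesis
    using that by force
next
  case (arbitrary k)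
  have "deduction (Inference r ts)"
    using assms(1) p by (rule deduction_subtree)
  then have k: "k < length ts" "concl (ts ! k) = rule_concl r"
    using arbitrary by (auto elim: deduction.cases)
  have "arbitrary_premise_of t (p @ [k]) p"
    using p arbitrary by (auto simp: arbitrary_premise_of_def rule_at_def)
  \<comment> \<open>A segment need not start as high as possible, so two occurrences suffice
    whatever stands above \<open>p @ [k]\<close>.\<close>
  then have "segment t [p @ [k], p]"
    using p k last by (auto simp: segment_def formula_at_def subtree_append)
  then show thesis
    using that by force
qed

theorem theorem3:
  fixes \<Pi> :: "'a tree"
  assumes "deduction \<Pi>"
    and "normal_form \<Pi>"
  shows "\<forall>p. elim_major_premise \<Pi> p \<longrightarrow> assumption_at \<Pi> p"
proof (intro allI impI)
  fix p assume p: "elim_major_premise \<Pi> p"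
  then obtain s where s: "subtree \<Pi> p = Some s"
    by (auto simp: elim_major_premise_def)
  \<comment> \<open>This allows a segment to stop at \<open>p\<close>.\<close>
  have last: "\<not> arbitrary_premise_of \<Pi> p q" for q
    using p major_premise_not_arbitrary by (auto simp: elim_major_premise_def)
  show "assumption_at \<Pi> p"
  proof (cases s)
    case (Assumption i A)
    with s show ?thesis
      by (simp add: assumption_at_def)
  next
    case (Inference r ts)
    with s obtain ps where "segment \<Pi> ps" "last ps = p"
      using inference_conclusion_ends_segment[OF assms(1) _ last] by blast
    with p have "maximal_segment \<Pi> ps"
      by (simp add: maximal_segment_def)
    with assms(2) show ?thesis
      by (auto simp: normal_form_def)
  qed
qed

end
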